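(* Let $N\ge 0$ be an integer and let $\{x_n\}_{n\ge 0}$ and $\{b_n\}_{n\ge 0}$ be two sequences of nonzero complex numbers such that $x_k\neq b_i$ for all $0\le i,k\le N$ and $b_i\neq b_j$ for all $0\le i\ne j\le N$, and such that none of the denominators below vanish. For any $f(x)\in\mathcal{L}_N(P(x),Q(x))$ and all $x\neq 0$ we have the expansion $$f(x)=x^N\sum_{k=0}^{N}b_kH_k(N)\prod_{i=0}^{k-1}\theta(b_ix,b_i/x;p)\prod_{i=1}^{N-k}\theta(x_ix,x_i/x;p),$$ where, for any $0\le n\le N$, the coefficient is $$H_n(N)=\sum_{k=0}^{n}\frac{f(b_k)}{b_k^{N+1}}\,\frac{\theta(x_{N-n+1}b_n,x_{N-n+1}/b_n;p)}{\theta(x_{N-n+1}b_k,x_{N-n+1}/b_k;p)}\prod_{i=1}^{N-n}\frac{1}{\theta(x_ib_k,x_i/b_k;p)}\prod_{i=0,\,i\neq k}^{n}\frac{1}{\theta(b_ib_k,b_i/b_k;p)}.$$ (For $n=0$ the quotient involving $x_{N+1}$ has identical numerator and denominator and is understood to be $1$.)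
   Context: Let $p\in\mathbb{C}$, $|p|<1$. Write $(x;p)_\infty=\prod_{n=0}^\infty(1-xp^n)$. The modified Jacobi theta function is $\theta(x;p)=\prod_{n=0}^{\infty}(1-xp^n)(1-p^{n+1}/x)$ for $x\ne 0$, and $\theta(x_1,\dots,x_m;p)=\prod_{k=1}^m\theta(x_k;p)$. Empty products equal $1$. Define $P(x)=\theta(-x^2;p^2)\,(-p;p)_\infty$ and $Q(x)=x\,\theta(-px^2;p^2)\,(-p;p)_\infty$ for $x\ne0$, where $\theta(-px^2;p^2)=\prod_{n\ge 0}(1+p^{2n+1}x^2)(1+p^{2n+1}/x^2)$. For an integer $N\ge 0$, $\mathcal{L}_N(P(x),Q(x))$ denotes the set of all functions of the form $\sum_{k=0}^{N}\lambda_kP(x)^kQ(x)^{N-k}$ with complex coefficients $\lambda_k$ independent of $x$ ("elliptic Askey-Wilson polynomials of degree $N$"). *)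

theory Defs
  imports "HOL-Analysis.Analysis"
begin

definition qpoch_inf :: "complex \<Rightarrow> complex \<Rightarrow> complex" where
  "qpoch_inf x p = (\<Prod>n. 1 - x * p ^ n)"

definition theta :: "complex \<Rightarrow> complex \<Rightarrow> complex" where
  "theta x p = (\<Prod>n. (1 - x * p ^ n) * (1 - p ^ (n + 1) / x))"

definition thetas :: "complex list \<Rightarrow> complex \<Rightarrow> complex" where
  "thetas xs p = (\<Prod>x\<leftarrow>xs. theta x p)"

definition P_fun :: "complex \<Rightarrow> complex \<Rightarrow> complex" where
  "P_fun p x = theta (- (x\<^sup>2)) (p\<^sup>2) * qpoch_inf (- p) p"

definition Q_fun :: "complex \<Rightarrow> complex \<Rightarrow> complex" where
  "Q_fun p x = x * theta (- (p * x\<^sup>2)) (p\<^sup>2) * qpoch_inf (- p) p"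

text \<open>For \<open>p = 0\<close> the first argument of theta in \<^const>\<open>Q_fun\<close> is \<open>0\<close>, which is outside the
  domain of theta; the intended value is the product below, which division by zero yields
  there as well.\<close>

lemma theta_Q_fun_product:
  "theta (- (p * x\<^sup>2)) (p\<^sup>2) =
     (\<Prod>n. (1 + p ^ (2 * n + 1) * x\<^sup>2) * (1 + p ^ (2 * n + 1) / x\<^sup>2))"
proof -
  have 1: "(p\<^sup>2) ^ (n + 1) / (- (p * x\<^sup>2)) = - (p ^ (2 * n + 1) / x\<^sup>2)" for n
    by (cases "p = 0")
       (simp_all add: power_mult [symmetric] power_add power2_eq_square mult_2_right field_simps)
  have 2: "- (p * x\<^sup>2) * (p\<^sup>2) ^ n = - (p ^ (2 * n + 1) * x\<^sup>2)" for n
    by (simp add: power_mult [symmetric] mult_ac)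
  show ?thesis
    unfolding theta_def 1 2 by simp
qed

text \<open>The members are functions on the nonzero complex numbers; their value at \<open>0\<close> is
  unconstrained.\<close>

definition elliptic_AW :: "complex \<Rightarrow> nat \<Rightarrow> (complex \<Rightarrow> complex) set" where
  "elliptic_AW p N =
     {f. \<exists>c :: nat \<Rightarrow> complex. \<forall>x. x \<noteq> 0 \<longrightarrow>
           f x = (\<Sum>k=0..N. c k * P_fun p x ^ k * Q_fun p x ^ (N - k))}"

text \<open>For \<open>n = 0\<close> the quotient involving \<open>x (N + 1)\<close> is \<open>1\<close> by convention, even if its numerator
  and denominator vanish.\<close>

definition H_coeff ::
  "complex \<Rightarrow> (nat \<Rightarrow> complex) \<Rightarrow> (nat \<Rightarrow> complex) \<Rightarrow> (complex \<Rightarrow> complex) \<Rightarrow> nat \<Rightarrow> nat \<Rightarrow> complex"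
where
  "H_coeff p x b f N n =
     (\<Sum>k=0..n.
        f (b k) / b k ^ (N + 1)
        * (if n = 0 then 1
           else thetas [x (N - n + 1) * b n, x (N - n + 1) / b n] p
                / thetas [x (N - n + 1) * b k, x (N - n + 1) / b k] p)
        * (\<Prod>i=1..N - n. 1 / thetas [x i * b k, x i / b k] p)
        * (\<Prod>i\<in>{0..n} - {k}. 1 / thetas [b i * b k, b i / b k] p))"

end

theory Submission
  imports Defs
begin

text \<open>
  Write \<open>W(u, v) = Q(u) P(v) - P(u) Q(v)\<close>. The addition formula \<open>theta_addition_formula\<close>
  says that \<open>u \<theta>(v u, v / u; p) = W(u, v)\<close>. After multiplication by powers of \<open>z\<close> and of the
  \<open>b k\<close>, every theta product in the expansion thus becomes a \<open>2 \<times> 2\<close> determinant, and the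
  members of \<open>elliptic_AW p N\<close> become binary forms of degree \<open>N\<close> in \<open>P\<close>, \<open>Q\<close>. What remains is
  algebra on the projective line.

  Let \<open>S\<^sub>n\<close> be the form of degree \<open>N\<close> that agrees with \<open>f\<close> at \<open>b 0, \<dots>, b n\<close> and vanishes at
  \<open>x 1, \<dots>, x (N - n)\<close>, given by Lagrange's formula. The form \<open>S\<^sub>N\<close> is \<open>f\<close> itself
  (\<open>wedge_lagrange_monomial\<close>). The difference \<open>S\<^sub>n - S\<^sub>n\<^sub>-\<^sub>1\<close> vanishes at \<open>b 0, \<dots>, b (n - 1)\<close> and
  at \<open>x 1, \<dots>, x (N - n)\<close>, so it is a constant multiple of the \<open>n\<close>-th product of the
  expansion, and the Pluecker relation identifies the constant as \<open>b n\<close> times \<open>H_coeff\<close> at \<open>n\<close>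
  (\<open>wedge_newton_expansion\<close>).

  The addition formula follows from the Jacobi triple product: in the double series for
  \<open>\<theta>(a x; p) \<theta>(a / x; p)\<close> the pairs of indices with even sum and those with odd sum each
  give a product of two theta functions with nome \<open>p\<^sup>2\<close>, namely those in \<open>P\<close> and \<open>Q\<close>. The
  triple product itself is the limit of its finite version with \<open>q\<close>-binomial coefficients.
\<close>

section \<open>The Jacobi triple product\<close>

lemma convergent_prod_one_minus_geometric:
  fixes c q :: complex
  assumes "norm q < 1"
  shows "convergent_prod (\<lambda>n. 1 - c * q ^ n)"
proof -
  have "summable (\<lambda>n. norm c * norm q ^ n)"
    using assms by (intro summable_mult summable_geometric) auto
  then have "abs_convergent_prod (\<lambda>n. 1 - c * q ^ n)"
    by (simp add: abs_convergent_prod_conv_summable norm_mult norm_power)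
  then show ?thesis
    by (rule abs_convergent_prod_imp_convergent_prod)
qed

text \<open>
  Dominated convergence for sums over an arbitrary index set. The bound makes the
  partial sums converge uniformly in the parameter, so the two limits may be exchanged.
\<close>

lemma dominated_has_sum:
  fixes f :: "nat \<Rightarrow> 'a \<Rightarrow> 'b :: banach"
  assumes sums: "\<And>n. (f n has_sum s n) A"
    and bound: "\<And>n x. x \<in> A \<Longrightarrow> norm (f n x) \<le> M x"
    and M: "M summable_on A"
    and lim: "\<And>x. x \<in> A \<Longrightarrow> (\<lambda>n. f n x) \<longlonglongrightarrow> g x"
    and s: "s \<longlonglongrightarrow> S"
  shows "(g has_sum S) A"
proof -
  have unif: "uniform_limit UNIV (\<lambda>X n. \<Sum>x\<in>X. f n x) s (finite_subsets_at_top A)"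
    by (rule Weierstrass_m_test_general'[where M = M]) (use bound sums M in auto)
  have "norm (g x) \<le> M x" if "x \<in> A" for x
    using tendsto_norm[OF lim[OF that]] bound[OF that]
    by (meson LIMSEQ_le_const2)
  then have "g summable_on A"
    using abs_summable_summable Infinite_Sum.abs_summable_on_comparison_test'[OF M] by blast
  then have g: "(g has_sum infsum g A) A" by simp
  have "s \<longlonglongrightarrow> infsum g A"
  proof (rule swap_uniform_limit'[OF _ g[unfolded has_sum_def] unif])
    show "\<forall>\<^sub>F X in finite_subsets_at_top A. (\<lambda>n. \<Sum>x\<in>X. f n x) \<longlonglongrightarrow> (\<Sum>x\<in>X. g x)"
      by (intro eventually_finite_subsets_at_top_weakI tendsto_sum lim) auto
  qed auto
  with s have "S = infsum g A" by (rule LIMSEQ_unique)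
  with g show ?thesis by simp
qed

text \<open>
  The finite product \<open>(q; q)\<^sub>m\<close>.
\<close>

definition qfact :: "complex \<Rightarrow> nat \<Rightarrow> complex" where
  "qfact q m = (\<Prod>k<m. 1 - q * q ^ k)"

text \<open>
  The reciprocal vanishes at negative arguments, like the reciprocal Gamma function. The
  recursion below then holds for all integers, and finite sums over a range of \<open>j\<close> can be
  written as sums over all integers.
\<close>

definition inv_qfact :: "complex \<Rightarrow> int \<Rightarrow> complex" where
  "inv_qfact q j = (if j < 0 then 0 else inverse (qfact q (nat j)))"

text \<open>
  The summand \<open>(- 1)\<^sup>j q\<^bsup>j(j-1)/2\<^esup> y\<^sup>j\<close> of the bilateral theta series.
\<close>

definition theta_term :: "complex \<Rightarrow> complex \<Rightarrow> int \<Rightarrow> complex" where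
  "theta_term q y j = q powi (j * (j - 1) div 2) * (- y) powi j"

lemma one_minus_power_nonzero:
  fixes q :: complex
  assumes "norm q < 1"
  shows "1 - q * q ^ k \<noteq> 0"
proof
  assume "1 - q * q ^ k = 0"
  then have "norm q ^ Suc k = 1"
    by (metis eq_iff_diff_eq_0 norm_one norm_power power_Suc)
  with assms show False
    using power_Suc_less_one[of "norm q" k] by (cases "norm q = 0") auto
qed

lemma qfact_nonzero: "norm q < 1 \<Longrightarrow> qfact q m \<noteq> 0"
  by (simp add: qfact_def one_minus_power_nonzero del: right_minus_eq)

lemma inv_qfact_pred:
  assumes "norm q < 1"
  shows "inv_qfact q (j - 1) = (1 - q powi j) * inv_qfact q j"
proof (cases "j \<le> 0")
  case True
  then show ?thesis by (cases "j = 0") (auto simp: inv_qfact_def)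
next
  case False
  then obtain m where j: "j = int (Suc m)"
    by (metis linorder_not_le zero_less_imp_eq_int Suc_pred)
  have "q powi j = q * q ^ m"
    unfolding j power_int_of_nat by simp
  moreover have "nat (j - 1) = m" "nat j = Suc m" using j by auto
  ultimately show ?thesis
    using False one_minus_power_nonzero[OF assms, of m]
    by (simp add: inv_qfact_def qfact_def)
qed

lemma qpoch_inf_nonzero:
  assumes "norm q < 1"
  shows "qpoch_inf q q \<noteq> 0"
  unfolding qpoch_inf_def
  by (rule prodinf_nonzero)
     (use convergent_prod_one_minus_geometric[OF assms, of q] one_minus_power_nonzero[OF assms] in auto)

lemma prod_lessThan_tendsto_prodinf:
  fixes f :: "nat \<Rightarrow> complex"
  assumes "convergent_prod f"
  shows "(\<lambda>n. \<Prod>k<n. f k) \<longlonglongrightarrow> prodinf f"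
  using convergent_prod_LIMSEQ[OF assms]
  by (simp add: LIMSEQ_lessThan_iff_atMost)

lemma qfact_tendsto:
  assumes "norm q < 1"
  shows "qfact q \<longlonglongrightarrow> qpoch_inf q q"
  unfolding qfact_def[abs_def] qpoch_inf_def
  by (rule prod_lessThan_tendsto_prodinf) (rule convergent_prod_one_minus_geometric[OF assms])

lemma theta_partial_tendsto:
  assumes "norm q < 1"
  shows "(\<lambda>n. \<Prod>k<n. (1 - y * q ^ k) * (1 - q ^ (k + 1) / y)) \<longlonglongrightarrow> theta y q"
proof -
  have "convergent_prod (\<lambda>k. (1 - y * q ^ k) * (1 - (q / y) * q ^ k))"
    by (intro convergent_prod_mult convergent_prod_one_minus_geometric assms)
  then show ?thesis
    unfolding theta_def by (intro prod_lessThan_tendsto_prodinf) (simp add: mult.commute)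
qed

lemma theta_term_pred:
  assumes "q \<noteq> 0" "y \<noteq> 0"
  shows "y * theta_term q y (j - 1) = - (q powi (1 - j) * theta_term q y j)"
proof -
  have "j * (j - 1) = (j - 1) * (j - 2) + (j - 1) * 2" by (simp add: algebra_simps)
  then have e: "(j - 1) * ((j - 1) - 1) div 2 = (1 - j) + j * (j - 1) div 2" by simp
  have "y * theta_term q y (j - 1)
      = q powi (1 - j) * q powi (j * (j - 1) div 2) * (y * (- y) powi (j - 1))"
    unfolding theta_term_def e using assms(1) by (simp add: power_int_add mult_ac)
  also have "y * (- y) powi (j - 1) = - ((- y) powi j)"
    using assms(2) by (simp add: power_int_diff field_simps)
  finally show ?thesis by (simp add: theta_term_def)
qed

lemma theta_term_succ:
  assumes "q \<noteq> 0" "y \<noteq> 0"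
  shows "theta_term q y (j + 1) / y = - (q powi j * theta_term q y j)"
  using theta_term_pred[OF assms, of "j + 1"] assms by (simp add: power_int_minus field_simps)

text \<open>
  The \<open>q\<close>-binomial coefficient of \<open>2 n\<close> over \<open>n + j\<close>, which is zero unless \<open>\<bar>j\<bar> \<le> n\<close>.
\<close>

definition jtp_coeff :: "complex \<Rightarrow> nat \<Rightarrow> int \<Rightarrow> complex" where
  "jtp_coeff q n j = qfact q (2 * n) * inv_qfact q (int n + j) * inv_qfact q (int n - j)"

text \<open>
  The coefficient recursion that multiplication of the \<open>n\<close>-th partial product by its next
  factor \<open>1 + q\<^bsup>2n+1\<^esup> - y q\<^sup>n - q\<^bsup>n+1\<^esup>/y\<close> amounts to. With \<open>U = q\<^bsup>n+1+j\<^esup>\<close> and \<open>V = q\<^bsup>n+1-j\<^esup>\<close> all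
  coefficients are multiples of one reciprocal product, and a polynomial identity in \<open>U\<close>,
  \<open>V\<close>, \<open>q\<close> remains.
\<close>

lemma jtp_coeff_Suc:
  assumes "norm q < 1" "q \<noteq> 0"
  shows "jtp_coeff q (Suc n) j =
    (1 + q ^ (2 * n + 1)) * jtp_coeff q n j
    + q ^ n * q powi (1 - j) * jtp_coeff q n (j - 1)
    + q ^ (n + 1) * q powi j * jtp_coeff q n (j + 1)"
proof -
  define u v where "u = int n + 1 + j" and "v = int n + 1 - j"
  define U V where "U = q powi u" and "V = q powi v"
  define r s where "r = inv_qfact q u" and "s = inv_qfact q v"
  have UV: "U * V = q ^ (2 * n + 2)"
    using assms unfolding U_def V_def u_def v_def
    by (simp add: power_int_add power_int_diff power_add mult_2 power2_eq_square)
  have U1: "inv_qfact q (u - 1) = (1 - U) * r" and V1: "inv_qfact q (v - 1) = (1 - V) * s"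
    unfolding U_def V_def r_def s_def by (rule inv_qfact_pred[OF assms(1)])+
  have U2: "inv_qfact q (u - 2) = (1 - U / q) * (1 - U) * r"
    using inv_qfact_pred[OF assms(1), of "u - 1"] U1 assms(2) by (simp add: U_def power_int_diff)
  have V2: "inv_qfact q (v - 2) = (1 - V / q) * (1 - V) * s"
    using inv_qfact_pred[OF assms(1), of "v - 1"] V1 assms(2) by (simp add: V_def power_int_diff)
  have c0: "jtp_coeff q n j = qfact q (2 * n) * ((1 - U) * r) * ((1 - V) * s)"
    unfolding jtp_coeff_def U1[symmetric] V1[symmetric] u_def v_def by simp
  have cm: "jtp_coeff q n (j - 1) = qfact q (2 * n) * ((1 - U / q) * (1 - U) * r) * s"
    unfolding jtp_coeff_def U2[symmetric] s_def u_def v_def by (simp add: algebra_simps)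
  have cp: "jtp_coeff q n (j + 1) = qfact q (2 * n) * r * ((1 - V / q) * (1 - V) * s)"
    unfolding jtp_coeff_def V2[symmetric] r_def u_def v_def by (simp add: algebra_simps)
  have cS: "jtp_coeff q (Suc n) j = qfact q (2 * n) * (1 - U * V / q) * (1 - U * V) * r * s"
    unfolding UV using assms(2)
    by (simp add: jtp_coeff_def qfact_def r_def s_def u_def v_def algebra_simps)
  have eV: "q ^ n * q powi (1 - j) = V" and eU: "q ^ (n + 1) * q powi j = U"
    unfolding U_def V_def u_def v_def using assms(2)
    by (simp_all add: power_int_add power_int_diff field_simps)
  have e1: "q ^ (2 * n + 1) = U * V / q"
    using UV assms(2) by simp
  show ?thesis
    unfolding eU eV e1 c0 cm cp cS using assms(2) by (simp add: field_simps)
qed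

text \<open>
  MacMahon's finite form of the Jacobi triple product.
\<close>

lemma jtp_finite:
  assumes "norm q < 1" "q \<noteq> 0" "y \<noteq> 0"
  shows "((\<lambda>j. theta_term q y j * jtp_coeff q n j) has_sum
    (\<Prod>k<n. (1 - y * q ^ k) * (1 - q ^ (k + 1) / y))) UNIV"
proof (induction n)
  case 0
  have "theta_term q y j * jtp_coeff q 0 j = (if j = 0 then 1 else 0)" for j
    by (auto simp: jtp_coeff_def inv_qfact_def qfact_def theta_term_def)
  then show ?case
    by (intro has_sum_finite_neutralI[of "{0}"]) auto
next
  case (Suc n)
  let ?f = "\<lambda>j. theta_term q y j * jtp_coeff q n j"
  let ?T = "\<Prod>k<n. (1 - y * q ^ k) * (1 - q ^ (k + 1) / y)"
  have dn: "((\<lambda>j. ?f (j - 1)) has_sum ?T) UNIV"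
    using Suc.IH by (subst has_sum_reindex_bij_witness[of _ "\<lambda>j. j + 1" "\<lambda>j. j - 1" UNIV ?f]) auto
  have up: "((\<lambda>j. ?f (j + 1)) has_sum ?T) UNIV"
    using Suc.IH by (subst has_sum_reindex_bij_witness[of _ "\<lambda>j. j - 1" "\<lambda>j. j + 1" UNIV ?f]) auto
  have "((\<lambda>j. (1 + q ^ (2 * n + 1)) * ?f j + (- y * q ^ n) * ?f (j - 1) + (- (q ^ (n + 1)) / y) * ?f (j + 1))
      has_sum ((1 + q ^ (2 * n + 1)) * ?T + (- y * q ^ n) * ?T + (- (q ^ (n + 1)) / y) * ?T)) UNIV"
    by (intro has_sum_add has_sum_cmult_right Suc.IH dn up)
  moreover have "(1 + q ^ (2 * n + 1)) * ?f j + (- y * q ^ n) * ?f (j - 1) + (- (q ^ (n + 1)) / y) * ?f (j + 1)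
      = theta_term q y j * jtp_coeff q (Suc n) j" for j
  proof -
    have "(- y * q ^ n) * ?f (j - 1) = - (y * theta_term q y (j - 1)) * q ^ n * jtp_coeff q n (j - 1)"
      by simp
    moreover have "(- (q ^ (n + 1)) / y) * ?f (j + 1)
        = - (theta_term q y (j + 1) / y) * q ^ (n + 1) * jtp_coeff q n (j + 1)"
      by simp
    ultimately show ?thesis
      unfolding theta_term_pred[OF assms(2,3)] theta_term_succ[OF assms(2,3)]
        jtp_coeff_Suc[OF assms(1,2)]
      by (simp add: algebra_simps)
  qed
  moreover have "(1 + q ^ (2 * n + 1)) * ?T + (- y * q ^ n) * ?T + (- (q ^ (n + 1)) / y) * ?T
      = ?T * ((1 - y * q ^ n) * (1 - q ^ (n + 1) / y))"
  proof -
    have "(1 - y * q ^ n) * (1 - q ^ (n + 1) / y) = (1 + q ^ (2 * n + 1)) - y * q ^ n - q ^ (n + 1) / y"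
      using assms(3) by (simp add: field_simps power_add power_mult power2_eq_square power_mult_distrib)
    moreover have "(1 + r) * t + (- y * q ^ n) * t + (- s / y) * t = t * ((1 + r) - y * q ^ n - s / y)" for r s t
      by (simp add: algebra_simps)
    ultimately show ?thesis by simp
  qed
  ultimately show ?case by simp
qed

lemma inv_qfact_tendsto:
  assumes "norm q < 1" and g: "filterlim g at_top sequentially"
  shows "(\<lambda>n. inv_qfact q (g n)) \<longlonglongrightarrow> inverse (qpoch_inf q q)"
proof -
  have "filterlim (\<lambda>n. nat (g n)) sequentially sequentially"
    using filterlim_compose[OF filterlim_nat_sequentially g] .
  then have "(\<lambda>n. inverse (qfact q (nat (g n)))) \<longlonglongrightarrow> inverse (qpoch_inf q q)"
    by (intro tendsto_inverse qpoch_inf_nonzero assms(1) filterlim_compose[OF qfact_tendsto[OF assms(1)]])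
  moreover have "\<forall>\<^sub>F n in sequentially. inverse (qfact q (nat (g n))) = inv_qfact q (g n)"
    using eventually_compose_filterlim[OF eventually_ge_at_top[of 0] g]
    by eventually_elim (simp add: inv_qfact_def)
  ultimately show ?thesis by (rule Lim_transform_eventually)
qed

lemma jtp_coeff_tendsto:
  assumes "norm q < 1"
  shows "(\<lambda>n. jtp_coeff q n j) \<longlonglongrightarrow> inverse (qpoch_inf q q)"
proof -
  let ?L = "qpoch_inf q q"
  have "(\<lambda>n. qfact q (2 * n)) \<longlonglongrightarrow> ?L"
    by (rule filterlim_compose[OF qfact_tendsto[OF assms]]) (rule filterlim_subseq, simp add: strict_mono_def)
  moreover have "filterlim (\<lambda>n. int n + i) at_top sequentially" for i
    unfolding filterlim_at_top eventually_sequentially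
  proof
    fix Z :: int
    show "\<exists>N. \<forall>n\<ge>N. Z \<le> int n + i" by (rule exI[of _ "nat (Z - i)"]) auto
  qed
  from this[of j] this[of "- j"]
  have "filterlim (\<lambda>n. int n + j) at_top sequentially" "filterlim (\<lambda>n. int n - j) at_top sequentially"
    by simp_all
  ultimately have "(\<lambda>n. jtp_coeff q n j) \<longlonglongrightarrow> ?L * inverse ?L * inverse ?L"
    unfolding jtp_coeff_def by (intro tendsto_mult inv_qfact_tendsto assms)
  then show ?thesis using qpoch_inf_nonzero[OF assms] by simp
qed

lemma jtp_coeff_bounded:
  assumes "norm q < 1"
  obtains K where "\<And>n j. norm (jtp_coeff q n j) \<le> K"
proof -
  have "Bseq (qfact q)"
    using qfact_tendsto[OF assms] convergentI convergent_imp_Bseq by blast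
  then obtain A where A: "A > 0" "\<And>n. norm (qfact q n) \<le> A"
    by (auto simp: Bseq_def)
  have "Bseq (\<lambda>n. inverse (qfact q n))"
    by (intro convergent_imp_Bseq
      convergentI[OF tendsto_inverse[OF qfact_tendsto[OF assms] qpoch_inf_nonzero[OF assms]]])
  then obtain B where B: "B > 0" "\<And>n. norm (inverse (qfact q n)) \<le> B"
    by (auto simp: Bseq_def)
  have B': "norm (inv_qfact q j) \<le> B" for j
    using B by (auto simp: inv_qfact_def)
  show thesis
  proof
    fix n j
    show "norm (jtp_coeff q n j) \<le> A * B * B"
      unfolding jtp_coeff_def norm_mult using A B B' by (intro mult_mono) auto
  qed
qed

text \<open>
  This majorises either half of the bilateral theta series: the quadratic exponent beats
  any geometric growth.
\<close>

lemma summable_quadratic_exponent: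
  fixes r s :: real
  assumes "0 \<le> r" "r < 1"
  shows "summable (\<lambda>n. r ^ (n * (n - 1) div 2) * s ^ n)"
proof -
  have "(\<lambda>n. r ^ n * \<bar>s\<bar>) \<longlonglongrightarrow> 0 * \<bar>s\<bar>"
    using assms by (intro tendsto_mult LIMSEQ_realpow_zero tendsto_const)
  then have "\<forall>\<^sub>F n in sequentially. r ^ n * \<bar>s\<bar> < 1 / 2"
    by (rule order_tendstoD) auto
  then obtain N where N: "\<And>n. n \<ge> N \<Longrightarrow> r ^ n * \<bar>s\<bar> < 1 / 2"
    by (auto simp: eventually_at_top_linorder)
  have step: "Suc n * (Suc n - 1) div 2 = n * (n - 1) div 2 + n" for n
  proof -
    have "Suc n * (Suc n - 1) = n * (n - 1) + n * 2" by (cases n) (auto simp: algebra_simps)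
    then show ?thesis by simp
  qed
  show ?thesis
  proof (rule summable_ratio_test[of "1/2" N])
    fix n assume "n \<ge> N"
    have "norm (r ^ (Suc n * (Suc n - 1) div 2) * s ^ Suc n)
        = (r ^ n * \<bar>s\<bar>) * norm (r ^ (n * (n - 1) div 2) * s ^ n)"
      unfolding step by (simp add: abs_mult power_abs power_add assms(1))
    also have "\<dots> \<le> 1 / 2 * norm (r ^ (n * (n - 1) div 2) * s ^ n)"
      using N[OF \<open>n \<ge> N\<close>] by (intro mult_right_mono) auto
    finally show "norm (r ^ (Suc n * (Suc n - 1) div 2) * s ^ Suc n)
        \<le> 1 / 2 * norm (r ^ (n * (n - 1) div 2) * s ^ n)" .
  qed simp
qed

lemma theta_term_abs_summable:
  assumes "norm q < 1" "q \<noteq> 0" "y \<noteq> 0"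
  shows "(\<lambda>j. norm (theta_term q y j)) summable_on UNIV"
proof -
  have norm_tt: "norm (theta_term q y j) = norm q powi (j * (j - 1) div 2) * norm y powi j" for j
    by (simp add: theta_term_def norm_mult norm_power_int)
  have tri: "int n * (int n - 1) div 2 = int (n * (n - 1) div 2)" for n
    by (cases n) (simp_all add: zdiv_int algebra_simps)
  have nn: "norm (theta_term q y (int n)) = norm q ^ (n * (n - 1) div 2) * norm y ^ n" for n
    unfolding norm_tt tri by simp
  \<comment> \<open>The half with negative index is a series of the same kind, with \<open>norm q / norm y\<close> in place
     of \<open>norm y\<close>.\<close>
  have "(- int n) * (- int n - 1) div 2 = int (n * (n - 1) div 2) + int n" for n
  proof -
    have "(- int n) * (- int n - 1) = int n * (int n - 1) + int n * 2" by (simp add: algebra_simps)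
    then show ?thesis by (simp add: tri)
  qed
  then have neg: "norm (theta_term q y (- int n)) = norm q ^ (n * (n - 1) div 2) * (norm q / norm y) ^ n" for n
    unfolding norm_tt using assms
    by (simp add: power_int_add power_int_minus power_divide field_simps)
  have "(\<lambda>n. norm (theta_term q y (int n))) summable_on UNIV"
    unfolding nn using assms by (intro summable_nonneg_imp_summable_on summable_quadratic_exponent) auto
  then have P: "(\<lambda>j. norm (theta_term q y j)) summable_on range int"
    by (subst summable_on_reindex) (auto simp: o_def)
  have "(\<lambda>n. norm (theta_term q y (- int n))) summable_on UNIV"
    unfolding neg using assms by (intro summable_nonneg_imp_summable_on summable_quadratic_exponent) auto
  then have M: "(\<lambda>j. norm (theta_term q y j)) summable_on range (\<lambda>n. - int n)"
    by (subst summable_on_reindex) (auto simp: o_def inj_on_def)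
  have "j \<in> range int \<union> range (\<lambda>n. - int n)" for j
    by (cases j rule: int_cases2) auto
  then have "range int \<union> range (\<lambda>n. - int n) = UNIV" by blast
  then show ?thesis using summable_on_union[OF P M] by simp
qed

text \<open>
  As \<open>n\<close> grows, each coefficient of the finite form tends to \<open>1 / (q; q)\<^sub>\<infinity>\<close> and all of them
  are bounded together, so the theta series dominates.
\<close>

theorem jacobi_triple_product:
  assumes "norm q < 1" "q \<noteq> 0" "y \<noteq> 0"
  shows "(theta_term q y has_sum qpoch_inf q q * theta y q) UNIV"
proof -
  obtain K where K: "\<And>n j. norm (jtp_coeff q n j) \<le> K"
    using jtp_coeff_bounded[OF assms(1)] by blast
  have "((\<lambda>j. theta_term q y j * inverse (qpoch_inf q q)) has_sum theta y q) UNIV"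
  proof (rule dominated_has_sum[OF jtp_finite[OF assms]])
    show "norm (theta_term q y j * jtp_coeff q n j) \<le> norm (theta_term q y j) * K" for n j
      using K by (simp add: norm_mult mult_left_mono)
    show "(\<lambda>j. norm (theta_term q y j) * K) summable_on UNIV"
      by (intro summable_on_cmult_left theta_term_abs_summable assms)
  qed (use assms in \<open>auto intro!: tendsto_mult jtp_coeff_tendsto theta_partial_tendsto[simplified]\<close>)
  from has_sum_cmult_right[OF this, of "qpoch_inf q q"] show ?thesis
    using qpoch_inf_nonzero[OF assms(1)] by (simp add: field_simps)
qed

section \<open>The addition formula\<close>

lemma has_sum_product:
  fixes f :: "'a \<Rightarrow> 'c :: {real_normed_field, banach}" and g :: "'b \<Rightarrow> 'c"
  assumes f: "(f has_sum S) A" "(\<lambda>i. norm (f i)) summable_on A"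
    and g: "(g has_sum T) B" "(\<lambda>j. norm (g j)) summable_on B"
  shows "((\<lambda>(i, j). f i * g j) has_sum S * T) (A \<times> B)"
proof (rule has_sum_SigmaI)
  show "((\<lambda>j. case (i, j) of (i, j) \<Rightarrow> f i * g j) has_sum f i * T) B" for i
    using g(1) by (simp add: has_sum_cmult_right)
  show "((\<lambda>i. f i * T) has_sum S * T) A"
    using f(1) by (rule has_sum_cmult_left)
  have "(\<lambda>ij. norm (case ij of (i, j) \<Rightarrow> f i * g j)) summable_on A \<times> B"
  proof (rule summable_on_SigmaI)
    show "((\<lambda>j. norm (case (i, j) of (i, j) \<Rightarrow> f i * g j)) has_sum norm (f i) * infsum (\<lambda>j. norm (g j)) B) B" for i
      using g(2) by (simp add: norm_mult has_sum_cmult_right)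
    show "(\<lambda>i. norm (f i) * infsum (\<lambda>j. norm (g j)) B) summable_on A"
      using f(2) by (rule summable_on_cmult_left)
  qed auto
  then show "(\<lambda>(i, j). f i * g j) summable_on A \<times> B"
    by (rule abs_summable_summable)
qed

lemma triangular_double: "2 * (j * (j - 1) div 2) = j * (j - 1)" for j :: int
  by simp

lemma theta_term_square_nome:
  "theta_term (p\<^sup>2) y j = p powi (j * (j - 1)) * (- y) powi j"
proof -
  have "(p\<^sup>2) powi (j * (j - 1) div 2) = p powi (2 * (j * (j - 1) div 2))"
    by (simp only: power_int_mult power_int_numeral)
  then show ?thesis
    unfolding theta_term_def triangular_double by simp
qed

lemma theta_term_product:
  assumes "p \<noteq> 0" "a \<noteq> 0" "x \<noteq> 0"
  shows "theta_term p (a * x) m * theta_term p (a / x) n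
    = p powi (m * (m - 1) div 2 + n * (n - 1) div 2) * (- a) powi (m + n) * x powi (m - n)"
proof -
  have "(- (a * x)) powi m = (- a) powi m * x powi m"
    by (metis power_int_mult_distrib mult_minus_left)
  moreover have "(- (a / x)) powi n = (- a) powi n / x powi n"
    by (metis power_int_divide_distrib minus_divide_left)
  ultimately show ?thesis
    using assms unfolding theta_term_def by (simp add: power_int_add power_int_diff)
qed

text \<open>
  The substitution \<open>m = u + v\<close>, \<open>n = u - v\<close> separates the variables, because
  \<open>m\<^sup>2 + n\<^sup>2 = 2 u\<^sup>2 + 2 v\<^sup>2\<close>; the exponent doubles, whence the nome \<open>p\<^sup>2\<close>. It reaches exactly
  the pairs with \<open>m + n\<close> even.
\<close>

lemma theta_term_product_even:
  assumes "p \<noteq> 0" "a \<noteq> 0" "x \<noteq> 0"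
  shows "theta_term p (a * x) (u + v) * theta_term p (a / x) (u - v)
    = theta_term (p\<^sup>2) (- (a\<^sup>2)) u * theta_term (p\<^sup>2) (- (p * x\<^sup>2)) v"
proof -
  have "2 * ((u + v) * ((u + v) - 1) div 2 + (u - v) * ((u - v) - 1) div 2)
      = 2 * (u * (u - 1) + (v * (v - 1) + v))"
    unfolding distrib_left triangular_double by (simp add: algebra_simps)
  then have "(u + v) * ((u + v) - 1) div 2 + (u - v) * ((u - v) - 1) div 2
      = u * (u - 1) + (v * (v - 1) + v)"
    by (metis mult_cancel_left zero_neq_numeral)
  moreover have "(u + v) + (u - v) = 2 * u" "(u + v) - (u - v) = 2 * v" by simp_all
  moreover have "(- a) powi (2 * u) = (a\<^sup>2) powi u" "x powi (2 * v) = (x\<^sup>2) powi v"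
    by (simp_all only: power_int_mult power_int_numeral power2_minus)
  ultimately show ?thesis
    using assms
    by (simp add: theta_term_product theta_term_square_nome power_int_add power_int_mult_distrib)
qed

text \<open>
  The counterpart for \<open>m + n\<close> odd. The shift sits in \<open>n = u - v + 1\<close>, so that the \<open>x\<close>-series
  is that of \<open>\<theta>(-x\<^sup>2; p\<^sup>2)\<close> itself and not of \<open>\<theta>(-p\<^sup>2x\<^sup>2; p\<^sup>2)\<close>.
\<close>

lemma theta_term_product_odd:
  assumes "p \<noteq> 0" "a \<noteq> 0" "x \<noteq> 0"
  shows "theta_term p (a * x) (u + v) * theta_term p (a / x) (u - v + 1)
    = - (a / x) * (theta_term (p\<^sup>2) (- (p * a\<^sup>2)) u * theta_term (p\<^sup>2) (- (x\<^sup>2)) v)"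
proof -
  have "2 * ((u + v) * ((u + v) - 1) div 2 + (u - v + 1) * ((u - v + 1) - 1) div 2)
      = 2 * (u * (u - 1) + u + v * (v - 1))"
    unfolding distrib_left triangular_double by (simp add: algebra_simps)
  then have "(u + v) * ((u + v) - 1) div 2 + (u - v + 1) * ((u - v + 1) - 1) div 2
      = u * (u - 1) + u + v * (v - 1)"
    by (metis mult_cancel_left zero_neq_numeral)
  moreover have "(u + v) + (u - v + 1) = 2 * u + 1" "(u + v) - (u - v + 1) = 2 * v - 1" by simp_all
  moreover have "(- a) powi (2 * u) = (a\<^sup>2) powi u" "x powi (2 * v) = (x\<^sup>2) powi v"
    by (simp_all only: power_int_mult power_int_numeral power2_minus)
  ultimately show ?thesis
    using assms
    by (simp add: theta_term_product theta_term_square_nome power_int_add power_int_diff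
        power_int_mult_distrib)
qed

lemma qpoch_inf_square_nome:
  assumes "norm p < 1"
  shows "qpoch_inf (p\<^sup>2) (p\<^sup>2) = qpoch_inf p p * qpoch_inf (- p) p"
proof -
  have "qpoch_inf p p * qpoch_inf (- p) p = (\<Prod>n. (1 - p * p ^ n) * (1 - (- p) * p ^ n))"
    unfolding qpoch_inf_def
    by (rule prodinf_mult) (rule convergent_prod_one_minus_geometric[OF assms])+
  moreover have "(1 - p * p ^ n) * (1 - (- p) * p ^ n) = 1 - p\<^sup>2 * (p\<^sup>2) ^ n" for n
    by (simp add: algebra_simps power2_eq_square power_mult_distrib)
  ultimately show ?thesis by (simp add: qpoch_inf_def)
qed

text \<open>
  Both theta functions on the left are expanded by the triple product; the double series
  is split by the parity of \<open>m + n\<close>, and each half is a product of two theta series with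
  nome \<open>p\<^sup>2\<close>. The normalising products combine by \<open>(p\<^sup>2; p\<^sup>2)\<^sub>\<infinity> = (p; p)\<^sub>\<infinity> (-p; p)\<^sub>\<infinity>\<close>.
\<close>

lemma theta_product_split:
  assumes "norm p < 1" "p \<noteq> 0" "a \<noteq> 0" "x \<noteq> 0"
  shows "theta (a * x) p * theta (a / x) p = (qpoch_inf (- p) p)\<^sup>2 *
    (theta (- (a\<^sup>2)) (p\<^sup>2) * theta (- (p * x\<^sup>2)) (p\<^sup>2)
     - a / x * (theta (- (p * a\<^sup>2)) (p\<^sup>2) * theta (- (x\<^sup>2)) (p\<^sup>2)))"
proof -
  define h where "h = (\<lambda>(m, n). theta_term p (a * x) m * theta_term p (a / x) n)"
  define L where "L = qpoch_inf p p"
  define L2 where "L2 = qpoch_inf (p\<^sup>2) (p\<^sup>2)"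
  let ?\<theta> = "\<lambda>y. theta y (p\<^sup>2)"
  have p2: "norm (p\<^sup>2) < 1" "p\<^sup>2 \<noteq> 0"
    using assms(1,2) power_less_one_iff[of "norm p" 2] by (auto simp: norm_power)
  have total: "(h has_sum (L * theta (a * x) p) * (L * theta (a / x) p)) UNIV"
    unfolding h_def L_def UNIV_Times_UNIV[symmetric]
    by (intro has_sum_product jacobi_triple_product theta_term_abs_summable) (use assms in auto)
  have term2: "((\<lambda>(u, v). theta_term (p\<^sup>2) y u * theta_term (p\<^sup>2) z v)
      has_sum (L2 * ?\<theta> y) * (L2 * ?\<theta> z)) UNIV" if "y \<noteq> 0" "z \<noteq> 0" for y z
    unfolding L2_def UNIV_Times_UNIV[symmetric]
    by (intro has_sum_product jacobi_triple_product theta_term_abs_summable p2 that)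
  define \<phi> \<psi> where "\<phi> = (\<lambda>(u::int, v). (u + v, u - v))" and "\<psi> = (\<lambda>(u::int, v). (u + v, u - v + 1))"
  have "(h \<circ> \<phi> has_sum (L2 * ?\<theta> (- (a\<^sup>2))) * (L2 * ?\<theta> (- (p * x\<^sup>2)))) UNIV"
    using term2[of "- (a\<^sup>2)" "- (p * x\<^sup>2)"] assms
    by (simp add: h_def \<phi>_def o_def case_prod_unfold theta_term_product_even)
  then have even: "(h has_sum (L2 * ?\<theta> (- (a\<^sup>2))) * (L2 * ?\<theta> (- (p * x\<^sup>2)))) (range \<phi>)"
    by (subst has_sum_reindex) (auto simp: inj_on_def \<phi>_def)
  have "(h \<circ> \<psi> has_sum - (a / x) * ((L2 * ?\<theta> (- (p * a\<^sup>2))) * (L2 * ?\<theta> (- (x\<^sup>2))))) UNIV"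
    using has_sum_cmult_right[OF term2[of "- (p * a\<^sup>2)" "- (x\<^sup>2)"], of "- (a / x)"] assms
    by (simp add: h_def \<psi>_def o_def case_prod_unfold theta_term_product_odd del: mult_minus_left)
  then have odd: "(h has_sum - (a / x) * ((L2 * ?\<theta> (- (p * a\<^sup>2))) * (L2 * ?\<theta> (- (x\<^sup>2))))) (range \<psi>)"
    by (subst has_sum_reindex) (auto simp: inj_on_def \<psi>_def)
  have disjoint: "range \<phi> \<inter> range \<psi> = {}"
    unfolding \<phi>_def \<psi>_def by (auto, presburger)
  have "(m, n) \<in> range \<phi> \<union> range \<psi>" for m n
  proof (cases "even (m + n)")
    case True
    then have "(m, n) = \<phi> ((m + n) div 2, (m - n) div 2)"
      unfolding \<phi>_def by auto presburger+
    then show ?thesis by blast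
  next
    case False
    then have "(m, n) = \<psi> ((m + n - 1) div 2, (m - n + 1) div 2)"
      unfolding \<psi>_def by auto presburger+
    then show ?thesis by blast
  qed
  then have "range \<phi> \<union> range \<psi> = UNIV" by auto
  then have "(L * theta (a * x) p) * (L * theta (a / x) p)
      = (L2 * ?\<theta> (- (a\<^sup>2))) * (L2 * ?\<theta> (- (p * x\<^sup>2)))
        + - (a / x) * ((L2 * ?\<theta> (- (p * a\<^sup>2))) * (L2 * ?\<theta> (- (x\<^sup>2))))"
    using has_sum_unique[OF total] has_sum_Un_disjoint[OF even odd disjoint] by metis
  moreover have "L2 = L * qpoch_inf (- p) p" "L \<noteq> 0"
    unfolding L_def L2_def using qpoch_inf_square_nome qpoch_inf_nonzero assms(1) by auto
  ultimately have "L\<^sup>2 * (theta (a * x) p * theta (a / x) p) = L\<^sup>2 * ((qpoch_inf (- p) p)\<^sup>2 *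
    (?\<theta> (- (a\<^sup>2)) * ?\<theta> (- (p * x\<^sup>2)) - a / x * (?\<theta> (- (p * a\<^sup>2)) * ?\<theta> (- (x\<^sup>2)))))"
    by (simp add: power2_eq_square algebra_simps)
  with \<open>L \<noteq> 0\<close> show ?thesis by simp
qed

lemma theta_nome_zero: "theta y 0 = 1 - y"
proof -
  have "theta y 0 = (\<Prod>n\<in>{0}. (1 - y * 0 ^ n) * (1 - 0 ^ (n + 1) / y))"
    unfolding theta_def by (rule prodinf_finite) auto
  then show ?thesis by simp
qed

lemma qpoch_inf_nome_zero: "qpoch_inf 0 0 = 1"
  by (simp add: qpoch_inf_def)

text \<open>
  The factors \<open>(-p; p)\<^sub>\<infinity>\<close> in \<open>P\<close> and \<open>Q\<close> absorb the constant that the change of nome from \<open>p\<close> to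
  \<open>p\<^sup>2\<close> produces. At \<open>p = 0\<close>, where the bilateral series degenerates, the formula reads
  \<open>x (1 - a x) (1 - a / x) = x (1 + a\<^sup>2) - (1 + x\<^sup>2) a\<close>.
\<close>

theorem theta_addition_formula:
  assumes "norm p < 1" "a \<noteq> 0" "x \<noteq> 0"
  shows "x * (theta (a * x) p * theta (a / x) p) = Q_fun p x * P_fun p a - P_fun p x * Q_fun p a"
proof (cases "p = 0")
  case True
  then show ?thesis
    using assms by (simp add: P_fun_def Q_fun_def theta_nome_zero qpoch_inf_nome_zero field_simps power2_eq_square)
next
  case False
  show ?thesis
    unfolding theta_product_split[OF assms(1) False assms(2,3)] P_fun_def Q_fun_def
    using assms(3) by (simp add: field_simps power2_eq_square)
qed

section \<open>Interpolation of binary forms\<close>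

text \<open>
  The determinant of the vectors \<open>(Q, P)\<close> at two points, an alternating form. Seen on
  the projective line with homogeneous coordinates \<open>(Q, P)\<close>, the map
  \<open>wedge P Q z v\<close>, as a function of \<open>z\<close>, is the linear form that vanishes at \<open>v\<close>.
\<close>

definition wedge :: "('a \<Rightarrow> 'b::field) \<Rightarrow> ('a \<Rightarrow> 'b) \<Rightarrow> 'a \<Rightarrow> 'a \<Rightarrow> 'b" where
  "wedge P Q u v = Q u * P v - P u * Q v"

lemma wedge_swap: "wedge P Q v u = - wedge P Q u v"
  by (simp add: wedge_def)

text \<open>
  The Pluecker relation between four vectors in the plane.
\<close>

lemma wedge_plucker:
  "wedge P Q z v * wedge P Q u w - wedge P Q z w * wedge P Q u v
     = wedge P Q z u * wedge P Q v w"
  by (simp add: wedge_def algebra_simps)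

text \<open>
  The induction step for Lagrange interpolation of forms on the projective line: if \<open>g\<close> of
  degree \<open>N\<close> is interpolated by the first \<open>N + 1\<close> nodes and \<open>l\<close> is linear, then \<open>l g\<close> is
  interpolated by \<open>N + 2\<close> nodes. Linearity enters only through the dependence of three
  vectors in the plane, the last assumption.
\<close>

lemma wedge_lagrange_mult:
  fixes b :: "nat \<Rightarrow> 'a" and P Q g l :: "'a \<Rightarrow> 'b::field"
  defines "W \<equiv> wedge P Q"
  assumes nz: "\<And>i j. i \<le> Suc N \<Longrightarrow> j \<le> Suc N \<Longrightarrow> i \<noteq> j \<Longrightarrow> W (b i) (b j) \<noteq> 0"
    and g: "\<And>z. g z = (\<Sum>k=0..N. g (b k) * (\<Prod>i\<in>{0..N} - {k}. W z (b i) / W (b k) (b i)))"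
    and l: "\<And>z u v. l u * W z v = l z * W u v + l v * W z u"
  shows "l z * g z = (\<Sum>k=0..Suc N. l (b k) * g (b k)
     * (\<Prod>i\<in>{0..Suc N} - {k}. W z (b i) / W (b k) (b i)))"
proof -
  define c where "c = b (Suc N)"
  define R where "R = (\<Prod>i=0..N. W z (b i))"
  define D where "D k = (\<Prod>i\<in>{0..N} - {k}. W (b k) (b i))" for k
  have Wc: "W (b k) c \<noteq> 0" "W c (b k) \<noteq> 0" if "k \<le> N" for k
    using nz[of k "Suc N"] nz[of "Suc N" k] that by (auto simp: c_def)
  have Dnz: "D k \<noteq> 0" if "k \<le> N" for k
    using nz that by (auto simp: D_def)
  have setk: "{0..Suc N} - {k} = insert (Suc N) ({0..N} - {k})" if "k \<le> N" for k
    using that by auto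
  have setS: "{0..Suc N} - {Suc N} = {0..N}" by auto
  have W_swap: "W u v = - W v u" for u v
    unfolding W_def by (rule wedge_swap)
  have summand: "l (b k) * g (b k) * (\<Prod>i\<in>{0..Suc N} - {k}. W z (b i) / W (b k) (b i))
      = l z * (g (b k) * (\<Prod>i\<in>{0..N} - {k}. W z (b i) / W (b k) (b i)))
        - l c * R * (g (b k) / (W c (b k) * D k))" if "k \<le> N" for k
  proof -
    have split: "R = W z (b k) * (\<Prod>i\<in>{0..N} - {k}. W z (b i))"
      unfolding R_def using that by (subst prod.remove[of _ k]) auto
    have "l (b k) * g (b k) * (\<Prod>i\<in>{0..Suc N} - {k}. W z (b i) / W (b k) (b i))
        = l (b k) * W z c / W (b k) c * g (b k) * (\<Prod>i\<in>{0..N} - {k}. W z (b i)) / D k"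
      unfolding setk[OF that] by (simp add: prod_dividef c_def D_def)
    \<comment> \<open>Linear dependence moves \<open>l\<close> from the node \<open>b k\<close> to the point \<open>z\<close>, at the cost of a
       multiple of the product \<open>R\<close> over all old nodes.\<close>
    also have "l (b k) * W z c = l z * W (b k) c + l c * W z (b k)"
      by (rule l)
    finally show ?thesis
      unfolding split prod_dividef D_def[symmetric] W_swap[of c]
      using Wc[OF that] Dnz[OF that] by (simp add: field_simps)
  qed
  \<comment> \<open>The multiples of \<open>R\<close> cancel against the summand of the new node \<open>c\<close>: this is the
     interpolation formula for \<open>g\<close> at \<open>c\<close>, divided by the node product there.\<close>
  have gc: "g c / (\<Prod>i=0..N. W c (b i)) = (\<Sum>k=0..N. g (b k) / (W c (b k) * D k))"
  proof -
    have "g c / (\<Prod>i=0..N. W c (b i)) =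
        (\<Sum>k=0..N. g (b k) * (\<Prod>i\<in>{0..N} - {k}. W c (b i) / W (b k) (b i)) / (\<Prod>i=0..N. W c (b i)))"
      by (subst g) (simp add: sum_divide_distrib)
    also have "\<dots> = (\<Sum>k=0..N. g (b k) / (W c (b k) * D k))"
    proof (rule sum.cong)
      fix k assume k: "k \<in> {0..N}"
      then have *: "(\<Prod>i=0..N. W c (b i)) = W c (b k) * (\<Prod>i\<in>{0..N} - {k}. W c (b i))"
        by (subst prod.remove[of _ k]) auto
      have "(\<Prod>i\<in>{0..N} - {k}. W c (b i)) \<noteq> 0" using Wc by auto
      then show "g (b k) * (\<Prod>i\<in>{0..N} - {k}. W c (b i) / W (b k) (b i)) / (\<Prod>i=0..N. W c (b i))
          = g (b k) / (W c (b k) * D k)"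
        unfolding * prod_dividef D_def[symmetric] by (simp add: field_simps)
    qed simp
    finally show ?thesis .
  qed
  have "(\<Sum>k=0..Suc N. l (b k) * g (b k) * (\<Prod>i\<in>{0..Suc N} - {k}. W z (b i) / W (b k) (b i)))
    = (\<Sum>k=0..N. l z * (g (b k) * (\<Prod>i\<in>{0..N} - {k}. W z (b i) / W (b k) (b i)))
        - l c * R * (g (b k) / (W c (b k) * D k)))
      + l c * g c * (\<Prod>i=0..N. W z (b i) / W c (b i))"
    unfolding sum.atLeast0_atMost_Suc setS c_def[symmetric] using summand by (simp cong: sum.cong_simp)
  also have "\<dots> = l z * g z - l c * R * (g c / (\<Prod>i=0..N. W c (b i)))
      + l c * g c * (\<Prod>i=0..N. W z (b i) / W c (b i))"
    unfolding sum_subtractf sum_distrib_left[symmetric] g[of z, symmetric] gc ..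
  also have "\<dots> = l z * g z"
    by (simp add: prod_dividef R_def)
  finally show ?thesis ..
qed

lemma wedge_lagrange_monomial:
  fixes b :: "nat \<Rightarrow> 'a" and P Q :: "'a \<Rightarrow> 'b::field"
  assumes "\<And>i j. i \<le> k + m \<Longrightarrow> j \<le> k + m \<Longrightarrow> i \<noteq> j \<Longrightarrow> wedge P Q (b i) (b j) \<noteq> 0"
  shows "P z ^ k * Q z ^ m = (\<Sum>n=0..k + m. P (b n) ^ k * Q (b n) ^ m
     * (\<Prod>i\<in>{0..k + m} - {n}. wedge P Q z (b i) / wedge P Q (b n) (b i)))"
  using assms
proof (induction "k + m" arbitrary: k m z)
  case 0
  then show ?case by simp
next
  case (Suc N)
  show ?case
  proof (cases k)
    case 0
    then obtain m' where m: "m = Suc m'" "N = m'" using Suc.hyps by (cases m) auto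
    have "Q z * Q z ^ m' = (\<Sum>n=0..Suc N. Q (b n) * Q (b n) ^ m'
        * (\<Prod>i\<in>{0..Suc N} - {n}. wedge P Q z (b i) / wedge P Q (b n) (b i)))"
    proof (rule wedge_lagrange_mult)
      show "Q z ^ m' = (\<Sum>n=0..N. Q (b n) ^ m' * (\<Prod>i\<in>{0..N} - {n}. wedge P Q z (b i) / wedge P Q (b n) (b i)))" for z
        using Suc.hyps(1)[of 0 m' z] Suc.prems 0 m by simp
    qed (use Suc.prems 0 m in \<open>auto simp: wedge_def algebra_simps\<close>)
    then show ?thesis using 0 m by simp
  next
    case (Suc k')
    then have N: "N = k' + m" using Suc.hyps by simp
    have "P z * (P z ^ k' * Q z ^ m) = (\<Sum>n=0..Suc N. P (b n) * (P (b n) ^ k' * Q (b n) ^ m)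
        * (\<Prod>i\<in>{0..Suc N} - {n}. wedge P Q z (b i) / wedge P Q (b n) (b i)))"
    proof (rule wedge_lagrange_mult)
      show "P z ^ k' * Q z ^ m = (\<Sum>n=0..N. P (b n) ^ k' * Q (b n) ^ m
          * (\<Prod>i\<in>{0..N} - {n}. wedge P Q z (b i) / wedge P Q (b n) (b i)))" for z
        unfolding N by (rule Suc.hyps(1)[OF N]) (use Suc.prems Suc N in auto)
    qed (use Suc.prems Suc N in \<open>auto simp: wedge_def algebra_simps\<close>)
    then show ?thesis using Suc N by (simp add: mult.assoc)
  qed
qed

text \<open>
  The left-hand side interpolates \<open>f\<close> in degree \<open>N\<close> at \<open>b 0, \<dots>, b n\<close> with prescribed zeros
  \<open>x 1, \<dots>, x (N - n)\<close>. Passing from \<open>n\<close> to \<open>n + 1\<close> exchanges the zero \<open>x (N - n)\<close> for the node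
  \<open>b (n + 1)\<close>, and the Pluecker relation shows that each summand changes by a multiple of
  the form with zeros \<open>b 0, \<dots>, b n\<close> and \<open>x 1, \<dots>, x (N - n - 1)\<close>. Hence the interpolants
  telescope into a Newton series.
\<close>

lemma wedge_newton_expansion:
  fixes b x :: "nat \<Rightarrow> 'a" and P Q :: "'a \<Rightarrow> 'b::field" and f :: "'a \<Rightarrow> 'b"
  defines "W \<equiv> wedge P Q"
  assumes bb: "\<And>i j. i \<le> N \<Longrightarrow> j \<le> N \<Longrightarrow> i \<noteq> j \<Longrightarrow> W (b i) (b j) \<noteq> 0"
    and bx: "\<And>i k. 1 \<le> i \<Longrightarrow> i \<le> N \<Longrightarrow> k \<le> Suc N - i \<Longrightarrow> W (b k) (x i) \<noteq> 0"
    and n: "n \<le> N"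
  shows "(\<Sum>k=0..n. f (b k) * (\<Prod>i=1..N - n. W z (x i) / W (b k) (x i))
        * (\<Prod>i\<in>{0..n} - {k}. W z (b i) / W (b k) (b i)))
    = (\<Sum>m=0..n. (\<Sum>k=0..m. f (b k)
          * (if m = 0 then 1 else W (b m) (x (N - m + 1)) / W (b k) (x (N - m + 1)))
          * (\<Prod>i=1..N - m. 1 / W (b k) (x i)) * (\<Prod>i\<in>{0..m} - {k}. 1 / W (b k) (b i)))
        * (\<Prod>i\<in>{0..<m}. W z (b i)) * (\<Prod>i=1..N - m. W z (x i)))"
    (is "?S n = (\<Sum>m=0..n. ?c m * ?Bz m * ?Xz m)")
proof -
  define T where "T m = ?c m * ?Bz m * ?Xz m" for m
  have "?S n = (\<Sum>m=0..n. T m)"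
    using n
  proof (induction n)
    case 0
    show ?case by (simp add: prod_dividef T_def)
  next
    case (Suc n)
    define y where "y = x (N - n)"
    define c where "c = b (Suc n)"
    define X where "X = (\<Prod>i=1..N - Suc n. W z (x i))"
    define XD where "XD k = (\<Prod>i=1..N - Suc n. W (b k) (x i))" for k
    define D where "D k = (\<Prod>i\<in>{0..n} - {k}. W (b k) (b i))" for k
    define B where "B k = (\<Prod>i\<in>{0..n} - {k}. W z (b i))" for k
    have Nn: "N - n = Suc (N - Suc n)" "N - Suc n + 1 = N - n" using Suc.prems by auto
    have setk: "{0..Suc n} - {k} = insert (Suc n) ({0..n} - {k})" if "k \<le> n" for k
      using that by auto
    have setS: "{0..Suc n} - {Suc n} = {0..n}" by auto
    have ivl: "{0..<Suc n} = {0..n}" by auto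
    have y_nz: "W (b k) y \<noteq> 0" if "k \<le> Suc n" for k
      unfolding y_def using bx[of "N - n" k] Suc.prems that by auto
    have c_nz: "W (b k) c \<noteq> 0" if "k \<le> n" for k
      unfolding c_def using bb that Suc.prems by auto
    have old: "(\<Sum>k=0..n. f (b k) * (\<Prod>i=1..N - n. W z (x i) / W (b k) (x i))
          * (\<Prod>i\<in>{0..n} - {k}. W z (b i) / W (b k) (b i)))
        = (\<Sum>k=0..n. f (b k) * (X * W z y / (XD k * W (b k) y)) * (B k / D k))"
      unfolding Nn prod_dividef D_def B_def
      by (simp add: X_def XD_def y_def Nn)
    have new: "(\<Sum>k=0..Suc n. f (b k) * (\<Prod>i=1..N - Suc n. W z (x i) / W (b k) (x i))
          * (\<Prod>i\<in>{0..Suc n} - {k}. W z (b i) / W (b k) (b i)))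
        = (\<Sum>k=0..n. f (b k) * (X / XD k) * (B k * W z c / (D k * W (b k) c)))
          + f c * (X / XD (Suc n)) * ((\<Prod>i=0..n. W z (b i)) / (\<Prod>i=0..n. W c (b i)))"
      unfolding sum.atLeast0_atMost_Suc setS prod_dividef X_def[symmetric] XD_def[symmetric] c_def[symmetric]
      by (simp add: setk B_def D_def c_def mult.commute cong: sum.cong_simp)
    have coeff: "(\<Sum>k=0..Suc n. f (b k)
            * (if Suc n = 0 then 1 else W (b (Suc n)) (x (N - Suc n + 1)) / W (b k) (x (N - Suc n + 1)))
            * (\<Prod>i=1..N - Suc n. 1 / W (b k) (x i)) * (\<Prod>i\<in>{0..Suc n} - {k}. 1 / W (b k) (b i)))
        = (\<Sum>k=0..n. f (b k) * (W c y / W (b k) y) / XD k / (D k * W (b k) c))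
          + f c / XD (Suc n) / (\<Prod>i=0..n. W c (b i))"
      unfolding sum.atLeast0_atMost_Suc setS prod_dividef XD_def[symmetric] Nn(2) y_def[symmetric] c_def[symmetric]
      using y_nz[of "Suc n"]
      by (simp add: setk D_def c_def mult.commute cong: sum.cong_simp)
    \<comment> \<open>The new summand of node \<open>b k\<close> is the old one plus its contribution to the coefficient of
       index \<open>n + 1\<close>.\<close>
    have telescope: "f (b k) * (X / XD k) * (B k * W z c / (D k * W (b k) c))
        = f (b k) * (X * W z y / (XD k * W (b k) y)) * (B k / D k)
          + f (b k) * (W c y / W (b k) y) / XD k / (D k * W (b k) c) * (\<Prod>i=0..n. W z (b i)) * X"
      if "k \<le> n" for k
    proof -
      have split: "(\<Prod>i=0..n. W z (b i)) = W z (b k) * B k"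
        unfolding B_def using that by (subst prod.remove[of _ k]) auto
      have "W z c * W (b k) y = W z y * W (b k) c + W z (b k) * W c y"
        using wedge_plucker[of P Q z c "b k" y] by (simp add: W_def algebra_simps)
      then have "W z c / W (b k) c = W z y / W (b k) y + W z (b k) * W c y / (W (b k) y * W (b k) c)"
        using y_nz[of k] c_nz[of k] that by (simp add: field_simps)
      then have "f (b k) * X * B k / XD k / D k * (W z c / W (b k) c)
          = f (b k) * X * B k / XD k / D k * (W z y / W (b k) y + W z (b k) * W c y / (W (b k) y * W (b k) c))"
        by simp
      then show ?thesis
        unfolding split by (simp add: algebra_simps)
    qed
    have "(\<Sum>k=0..n. f (b k) * (X / XD k) * (B k * W z c / (D k * W (b k) c)))
        = (\<Sum>k=0..n. f (b k) * (X * W z y / (XD k * W (b k) y)) * (B k / D k))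
          + (\<Sum>k=0..n. f (b k) * (W c y / W (b k) y) / XD k / (D k * W (b k) c)) * (\<Prod>i=0..n. W z (b i)) * X"
      unfolding sum_distrib_right sum.distrib[symmetric] by (intro sum.cong refl telescope) auto
    then have "?S (Suc n) = ?S n + T (Suc n)"
      unfolding new old T_def coeff ivl X_def[symmetric] by (simp add: distrib_right)
    then show ?case
      using Suc.IH Suc.prems by simp
  qed
  then show ?thesis unfolding T_def .
qed

section \<open>The expansion\<close>

lemma thetas_eq_wedge:
  assumes "norm p < 1" "u \<noteq> 0" "v \<noteq> 0"
  shows "thetas [v * u, v / u] p = wedge (P_fun p) (Q_fun p) u v / u"
  using theta_addition_formula[OF assms(1,3,2)] assms(2)
  by (simp add: thetas_def wedge_def field_simps)

lemma elliptic_AW_lagrange: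
  assumes f: "f \<in> elliptic_AW p N"
    and bb: "\<And>i j. i \<le> N \<Longrightarrow> j \<le> N \<Longrightarrow> i \<noteq> j \<Longrightarrow> wedge (P_fun p) (Q_fun p) (b i) (b j) \<noteq> 0"
    and b: "\<And>n. b n \<noteq> 0" and z: "z \<noteq> 0"
  shows "f z = (\<Sum>n=0..N. f (b n) * (\<Prod>i\<in>{0..N} - {n}.
      wedge (P_fun p) (Q_fun p) z (b i) / wedge (P_fun p) (Q_fun p) (b n) (b i)))"
proof -
  let ?L = "\<lambda>n. \<Prod>i\<in>{0..N} - {n}.
      wedge (P_fun p) (Q_fun p) z (b i) / wedge (P_fun p) (Q_fun p) (b n) (b i)"
  obtain c where c: "\<And>x. x \<noteq> 0 \<Longrightarrow> f x = (\<Sum>k=0..N. c k * P_fun p x ^ k * Q_fun p x ^ (N - k))"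
    using f by (auto simp: elliptic_AW_def)
  have "f z = (\<Sum>k=0..N. c k * (P_fun p z ^ k * Q_fun p z ^ (N - k)))"
    using c[OF z] by (simp add: mult.assoc)
  also have "\<dots> = (\<Sum>k=0..N. c k * (\<Sum>n=0..N. P_fun p (b n) ^ k * Q_fun p (b n) ^ (N - k) * ?L n))"
  proof (intro sum.cong refl arg_cong2[where f = "(*)"])
    fix k assume "k \<in> {0..N}"
    then have "k + (N - k) = N" by simp
    then show "P_fun p z ^ k * Q_fun p z ^ (N - k)
        = (\<Sum>n=0..N. P_fun p (b n) ^ k * Q_fun p (b n) ^ (N - k) * ?L n)"
      using wedge_lagrange_monomial[of k "N - k" "P_fun p" "Q_fun p" b z] bb by simp
  qed
  also have "\<dots> = (\<Sum>n=0..N. f (b n) * ?L n)"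
    unfolding c[OF b] sum_distrib_left sum_distrib_right
    by (subst sum.swap) (simp add: mult_ac)
  finally show ?thesis .
qed

text \<open>
  In each summand the passage from theta functions to determinants produces \<open>b k\<close> to the
  power \<open>N + 1\<close>: one factor from the quotient with \<open>x (N - n + 1)\<close> (together with the factor
  \<open>b n\<close> outside), \<open>N - n\<close> and \<open>n\<close> from the two products. This is what the denominator of
  \<open>H_coeff\<close> cancels.
\<close>

lemma H_coeff_eq_wedge:
  fixes p :: complex and x b :: "nat \<Rightarrow> complex"
  defines "W \<equiv> wedge (P_fun p) (Q_fun p)"
  assumes p: "norm p < 1" and x: "\<And>n. x n \<noteq> 0" and b: "\<And>n. b n \<noteq> 0" and n: "n \<le> N"
  shows "b n * H_coeff p x b f N n = (\<Sum>k=0..n. f (b k)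
      * (if n = 0 then 1 else W (b n) (x (N - n + 1)) / W (b k) (x (N - n + 1)))
      * (\<Prod>i=1..N - n. 1 / W (b k) (x i)) * (\<Prod>i\<in>{0..n} - {k}. 1 / W (b k) (b i)))"
  unfolding H_coeff_def sum_distrib_left
proof (rule sum.cong)
  fix k assume k: "k \<in> {0..n}"
  let ?y = "x (N - n + 1)"
  define q where "q = (if n = 0 then 1 else W (b n) ?y / W (b k) ?y)"
  define X where "X = (\<Prod>i=1..N - n. 1 / W (b k) (x i))"
  define B where "B = (\<Prod>i\<in>{0..n} - {k}. 1 / W (b k) (b i))"
  have to_W: "thetas [v * u, v / u] p = W u v / u" if "u \<noteq> 0" "v \<noteq> 0" for u v
    unfolding W_def by (rule thetas_eq_wedge[OF p that])
  \<comment> \<open>For \<open>n = 0\<close> the only index is \<open>k = 0\<close>, and the outer factor \<open>b n\<close> is the required \<open>b k\<close>.\<close>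
  have quot: "b n * (if n = 0 then 1 else thetas [?y * b n, ?y / b n] p / thetas [?y * b k, ?y / b k] p)
      = b k * q"
    using k b by (auto simp: q_def to_W x)
  have prod_x: "(\<Prod>i=1..N - n. 1 / thetas [x i * b k, x i / b k] p) = b k ^ (N - n) * X"
    by (simp add: to_W x b X_def prod_dividef)
  have prod_b: "(\<Prod>i\<in>{0..n} - {k}. 1 / thetas [b i * b k, b i / b k] p) = b k ^ n * B"
    using k by (simp add: to_W b B_def prod_dividef)
  have pow: "b k * (b k ^ (N - n) * b k ^ n) = b k ^ (N + 1)"
    using n by (simp add: power_add[symmetric])
  have "b n * (f (b k) / b k ^ (N + 1)
      * (if n = 0 then 1 else thetas [?y * b n, ?y / b n] p / thetas [?y * b k, ?y / b k] p)
      * (b k ^ (N - n) * X) * (b k ^ n * B))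
    = (b n * (if n = 0 then 1 else thetas [?y * b n, ?y / b n] p / thetas [?y * b k, ?y / b k] p))
      * (f (b k) / b k ^ (N + 1)) * (b k ^ (N - n) * X) * (b k ^ n * B)"
    by (simp only: mult_ac)
  also have "\<dots> = (b k * (b k ^ (N - n) * b k ^ n)) / b k ^ (N + 1) * (f (b k) * q * X * B)"
    unfolding quot by (simp add: mult_ac)
  also have "\<dots> = f (b k) * q * X * B"
    unfolding pow using b by simp
  finally show "b n * (f (b k) / b k ^ (N + 1)
      * (if n = 0 then 1 else thetas [?y * b n, ?y / b n] p / thetas [?y * b k, ?y / b k] p)
      * (\<Prod>i=1..N - n. 1 / thetas [x i * b k, x i / b k] p)
      * (\<Prod>i\<in>{0..n} - {k}. 1 / thetas [b i * b k, b i / b k] p))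
    = f (b k) * (if n = 0 then 1 else W (b n) ?y / W (b k) ?y)
      * (\<Prod>i=1..N - n. 1 / W (b k) (x i)) * (\<Prod>i\<in>{0..n} - {k}. 1 / W (b k) (b i))"
    unfolding prod_x prod_b q_def[symmetric] X_def[symmetric] B_def[symmetric] .
qed simp

theorem theorem1p10:
  fixes p :: complex and N :: nat and x b :: "nat \<Rightarrow> complex"
    and f :: "complex \<Rightarrow> complex" and z :: complex
  assumes "norm p < 1"
    and "\<And>n. x n \<noteq> 0"
    and "\<And>n. b n \<noteq> 0"
    and "\<And>i k. i \<le> N \<Longrightarrow> k \<le> N \<Longrightarrow> x k \<noteq> b i"
    and "\<And>i j. i \<le> N \<Longrightarrow> j \<le> N \<Longrightarrow> i \<noteq> j \<Longrightarrow> b i \<noteq> b j"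
    and "\<And>n k. 1 \<le> n \<Longrightarrow> n \<le> N \<Longrightarrow> k \<le> n \<Longrightarrow>
           thetas [x (N - n + 1) * b k, x (N - n + 1) / b k] p \<noteq> 0"
    and "\<And>n k i. n \<le> N \<Longrightarrow> k \<le> n \<Longrightarrow> i \<in> {1..N - n} \<Longrightarrow>
           thetas [x i * b k, x i / b k] p \<noteq> 0"
    and "\<And>n k i. n \<le> N \<Longrightarrow> k \<le> n \<Longrightarrow> i \<in> {0..n} - {k} \<Longrightarrow>
           thetas [b i * b k, b i / b k] p \<noteq> 0"
    and "f \<in> elliptic_AW p N"
    and "z \<noteq> 0"
  shows "f z = z ^ N * (\<Sum>k=0..N. b k * H_coeff p x b f N k
           * (\<Prod>i\<in>{0..<k}. thetas [b i * z, b i / z] p)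
           * (\<Prod>i=1..N - k. thetas [x i * z, x i / z] p))"
proof -
  define W where "W = wedge (P_fun p) (Q_fun p)"
  note p = assms(1) and x = assms(2) and b = assms(3) and z = assms(10)
  have to_W: "thetas [v * u, v / u] p = W u v / u" if "u \<noteq> 0" "v \<noteq> 0" for u v
    unfolding W_def by (rule thetas_eq_wedge[OF p that])
  have bb: "W (b i) (b j) \<noteq> 0" if "i \<le> N" "j \<le> N" "i \<noteq> j" for i j
    using assms(8)[of N i j] that by (auto simp: to_W b)
  have bx: "W (b k) (x i) \<noteq> 0" if "1 \<le> i" "i \<le> N" "k \<le> Suc N - i" for i k
    using assms(6)[of "Suc N - i" k] that by (auto simp: to_W b x Suc_diff_le)
  have summand: "z ^ N * (b k * H_coeff p x b f N k * (\<Prod>i\<in>{0..<k}. thetas [b i * z, b i / z] p)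
        * (\<Prod>i=1..N - k. thetas [x i * z, x i / z] p))
      = b k * H_coeff p x b f N k * (\<Prod>i\<in>{0..<k}. W z (b i)) * (\<Prod>i=1..N - k. W z (x i))"
    if "k \<le> N" for k
  proof -
    have "z ^ N = z ^ k * z ^ (N - k)"
      using that by (simp add: power_add[symmetric])
    then show ?thesis
      using z by (simp add: to_W b x prod_dividef)
  qed
  have "f z = (\<Sum>k=0..N. f (b k) * (\<Prod>i\<in>{0..N} - {k}. W z (b i) / W (b k) (b i)))"
    unfolding W_def by (rule elliptic_AW_lagrange) (use assms(9) b z bb in \<open>auto simp: W_def\<close>)
  also have "\<dots> = (\<Sum>k=0..N. f (b k) * (\<Prod>i=1..N - N. W z (x i) / W (b k) (x i))
        * (\<Prod>i\<in>{0..N} - {k}. W z (b i) / W (b k) (b i)))"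
    by simp
  also have "\<dots> = (\<Sum>k=0..N. b k * H_coeff p x b f N k
        * (\<Prod>i\<in>{0..<k}. W z (b i)) * (\<Prod>i=1..N - k. W z (x i)))"
  proof -
    have "b k * H_coeff p x b f N k = (\<Sum>j=0..k. f (b j)
        * (if k = 0 then 1 else W (b k) (x (N - k + 1)) / W (b j) (x (N - k + 1)))
        * (\<Prod>i=1..N - k. 1 / W (b j) (x i)) * (\<Prod>i\<in>{0..k} - {j}. 1 / W (b j) (b i)))"
      if "k \<le> N" for k
      unfolding W_def by (rule H_coeff_eq_wedge[OF p x b that])
    then show ?thesis
      using wedge_newton_expansion[of N "P_fun p" "Q_fun p" b x N f z, folded W_def, OF bb bx]
      by (simp cong: sum.cong_simp)
  qed
  also have "\<dots> = z ^ N * (\<Sum>k=0..N. b k * H_coeff p x b f N k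
        * (\<Prod>i\<in>{0..<k}. thetas [b i * z, b i / z] p)
        * (\<Prod>i=1..N - k. thetas [x i * z, x i / z] p))"
    unfolding sum_distrib_left by (intro sum.cong refl) (simp only: summand atLeastAtMost_iff)
  finally show ?thesis .
qed

end
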